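(* Let $a,b,c,d:[t_0,+\infty)\to\mathbb{H}$ be continuous, let $A(t),B(t),C(t),D(t)$ be the symbols (real $4\times4$ matrices) of $a(t),b(t),c(t),d(t)$, and consider the linear system $$\phi'=C(t)\phi+A(t)\psi,\qquad \psi'=-D(t)\phi-B(t)\psi,\qquad t\ge t_0,$$ for continuously differentiable vector functions $\phi,\psi$ of dimension $4$. Let $\theta$ denote the null vector of dimension $4$. (I) Let $\mathfrak{S}\subseteq\{0,1,2,3\}$ be nonempty and $\mathfrak{O}=\{0,1,2,3\}\setminus\mathfrak{S}$, and suppose that for all $t\ge t_0$: $a_n(t)\ge0$ for $n\in\mathfrak{S}$; whenever $a_n(t)=0$ for some $n\in\mathfrak{S}$, then $p_{n,m}(t)=0$ for $m=1,2,3$; $a_n(t)=0$ for $n\in\mathfrak{O}$; and $D_n(t)\le0$ for $n\in\mathfrak{S}$. Let $\gamma_0,\dots,\gamma_3$ be real numbers with $\gamma_n\ge0$ for $n\in\mathfrak{S}$, $\sum_{n\in\mathfrak{S}}\gamma_n\ne0$, and $\gamma_n\in(-\infty,+\infty)$ for $n\in\mathfrak{O}$. Then every solution $(\phi(t),\psi(t))$ of the system with $$\psi(t_0)=(\gamma_0E-\gamma_1I-\gamma_2J-\gamma_3K)\,\phi(t_0)\ne\theta$$ satisfies the completely non conjugation condition, i.e. $\phi(t)\ne\theta$ and $\psi(t)\ne\theta$ for all $t\ge t_0$. (II) Suppose that for some $\varepsilon>0$ and every $t\ge t_0$ the ordered quintuples $\mathcal{L}_0(t),\mathcal{L}_1(t),\mathcal{L}_2(t),\mathcal{L}_3(t)$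 are $\varepsilon$-semi definite positive. Let $\gamma_n>0$, $n=0,1,2,3$. Then every solution $(\phi(t),\psi(t))$ of the system with $$\psi(t_0)=(\gamma_0E-\gamma_1I-\gamma_2J-\gamma_3K)\,\phi(t_0)\ne\theta$$ satisfies the completely non conjugation condition, i.e. $\phi(t)\ne\theta$ and $\psi(t)\ne\theta$ for all $t\ge t_0$.
   Context: $\mathbb{H}$ denotes the real quaternions with imaginary units $i,j,k$ satisfying $i^2=j^2=k^2=ijk=-1$, $ij=-ji=k$. Write $a(t)=a_0(t)+i\,a_1(t)+j\,a_2(t)+k\,a_3(t)$ with $a_n$ real valued, and similarly $b(t)=b_0+ib_1+jb_2+kb_3$, $c(t)=c_0+ic_1+jc_2+kc_3$, $d(t)=d_0+id_1+jd_2+kd_3$; all component functions are continuous real valued functions on $[t_0,+\infty)$. Symbols. $E$ is the $4\times4$ identity matrix and $$I=\begin{pmatrix}0&1&0&0\\-1&0&0&0\\0&0&0&1\\0&0&-1&0\end{pmatrix},\quad J=\begin{pmatrix}0&0&1&0\\0&0&0&-1\\-1&0&0&0\\0&1&0&0\end{pmatrix},\quad K=\begin{pmatrix}0&0&0&-1\\0&0&-1&0\\0&1&0&0\\1&0&0&0\end{pmatrix}.$$ The symbol of a quaternion $m=m_0+im_1+jm_2+km_3$ is the matrix $\widehat m=m_0E+m_1I+m_2J+m_3K$. Definition. For $\varepsilon>0$, an ordered quintuple $(p,q,r,s,l)$ of real numbers is called $\varepsilon$-semi definite positive if: 1) $p>0$ and $l>0$; and 2) either $\max\{q,r,s\}\ge\sqrt{l+\varepsilon}$,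 or else $0\le\min\{q,r,s\}\le\max\{q,r,s\}\le\sqrt{l+\varepsilon}$ and $q^2+r^2+s^2\ge l+\varepsilon$. For $t\ge t_0$ put - $p_{0,m}=b_m+c_m$, $m=1,2,3$; - $p_{1,1}=b_1+c_1$, $p_{1,2}=b_2-c_2$, $p_{1,3}=b_3-c_3$; - $p_{2,1}=b_1-c_1$, $p_{2,2}=b_2+c_2$, $p_{2,3}=b_3-c_3$; - $p_{3,1}=b_1-c_1$, $p_{3,2}=b_2-c_2$, $p_{3,3}=b_3+c_3$. Define the scalar functions $D_0(t)=\sum_{m=1}^3 p_{0,m}^2(t)+4a_0(t)d_0(t)$ if $a_0(t)\ne0$ and $D_0(t)=4d_0(t)$ if $a_0(t)=0$; for $n=1,2,3$, $D_n(t)=\sum_{m=1}^3 p_{n,m}^2(t)-4a_n(t)d_n(t)$ if $a_n(t)\ne 0$ and $D_n(t)=-4d_n(t)$ if $a_n(t)=0$. (These are distinct from the matrix $D(t)$.) The quintuples are $$\mathcal{L}_0(t)=(a_0(t),\,-b_1(t)-c_1(t),\,-b_2(t)-c_2(t),\,-b_3(t)-c_3(t),\,D_0(t)),$$ $$\mathcal{L}_1(t)=(a_1(t),\,b_1(t)+c_1(t),\,-b_2(t)+c_2(t),\,b_3(t)-c_3(t),\,D_1(t)),$$ $$\mathcal{L}_2(t)=(a_2(t),\,b_1(t)-c_1(t),\,b_2(t)+c_2(t),\,-b_3(t)+c_3(t),\,D_2(t)),$$ $$\mathcal{L}_3(t)=(a_3(t),\,-b_1(t)+c_1(t),\,b_2(t)-c_2(t),\,b_3(t)+c_3(t),\,D_3(t)).$$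 *)

theory Defs
  imports "HOL-Analysis.Analysis"
begin

section \<open>Quaternions\<close>

datatype quat = Quat (qRe: real) (qIm1: real) (qIm2: real) (qIm3: real)

lemma quat_eq_iff:
  "q = r \<longleftrightarrow> qRe q = qRe r \<and> qIm1 q = qIm1 r \<and> qIm2 q = qIm2 r \<and> qIm3 q = qIm3 r"
  by (cases q; cases r) simp

instantiation quat :: ring_1
begin

definition "0 = Quat 0 0 0 0"
definition "1 = Quat 1 0 0 0"
definition "- q = Quat (- qRe q) (- qIm1 q) (- qIm2 q) (- qIm3 q)"
definition "q + r = Quat (qRe q + qRe r) (qIm1 q + qIm1 r) (qIm2 q + qIm2 r) (qIm3 q + qIm3 r)"
definition "q - r = Quat (qRe q - qRe r) (qIm1 q - qIm1 r) (qIm2 q - qIm2 r) (qIm3 q - qIm3 r)"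
definition "q * r = Quat
  (qRe q * qRe r - qIm1 q * qIm1 r - qIm2 q * qIm2 r - qIm3 q * qIm3 r)
  (qRe q * qIm1 r + qIm1 q * qRe r + qIm2 q * qIm3 r - qIm3 q * qIm2 r)
  (qRe q * qIm2 r - qIm1 q * qIm3 r + qIm2 q * qRe r + qIm3 q * qIm1 r)
  (qRe q * qIm3 r + qIm1 q * qIm2 r - qIm2 q * qIm1 r + qIm3 q * qRe r)"

instance
  by standard (auto simp: quat_eq_iff zero_quat_def one_quat_def uminus_quat_def
      plus_quat_def minus_quat_def times_quat_def algebra_simps)

end

lemma hamilton_relations:
  defines "i \<equiv> Quat 0 1 0 0" and "j \<equiv> Quat 0 0 1 0" and "k \<equiv> Quat 0 0 0 1"
  shows "i * i = - 1" "j * j = - 1" "k * k = - 1" "i * j * k = - 1" "i * j = k" "j * i = - k"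
  by (simp_all add: i_def j_def k_def times_quat_def uminus_quat_def one_quat_def)

instantiation quat :: real_vector
begin

definition "scaleR x q = Quat (x * qRe q) (x * qIm1 q) (x * qIm2 q) (x * qIm3 q)"

instance
  by standard (simp_all add: quat_eq_iff scaleR_quat_def plus_quat_def algebra_simps)

end

text \<open>The topology on the quaternions is the Euclidean one of their four components.\<close>

definition quat_to_R4 :: "quat \<Rightarrow> real \<times> real \<times> real \<times> real" where
  "quat_to_R4 q = (qRe q, qIm1 q, qIm2 q, qIm3 q)"

instantiation quat :: real_normed_vector
begin

definition "norm q = norm (quat_to_R4 q)"
definition "sgn (q :: quat) = q /\<^sub>R norm q"
definition "dist (q :: quat) r = norm (q - r)"
definition [code del]:
  "(uniformity :: (quat \<times> quat) filter) = (INF e\<in>{0 <..}. principal {(x, y). dist x y < e})"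
definition [code del]:
  "open (U :: quat set) \<longleftrightarrow> (\<forall>x\<in>U. eventually (\<lambda>(x', y). x' = x \<longrightarrow> y \<in> U) uniformity)"

instance
proof
  have add: "quat_to_R4 (q + r) = quat_to_R4 q + quat_to_R4 r" for q r
    by (simp add: quat_to_R4_def plus_quat_def)
  have scale: "quat_to_R4 (x *\<^sub>R q) = x *\<^sub>R quat_to_R4 q" for x q
    by (simp add: quat_to_R4_def scaleR_quat_def)
  have zero: "quat_to_R4 q = 0 \<longleftrightarrow> q = 0" for q
    by (cases q) (simp add: quat_to_R4_def zero_quat_def zero_prod_def)
  show "norm (q + r) \<le> norm q + norm r" for q r :: quat
    by (simp add: norm_quat_def add norm_triangle_ineq)
  show "norm (x *\<^sub>R q) = \<bar>x\<bar> * norm q" for x and q :: quat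
    by (simp add: norm_quat_def scale)
  show "norm q = 0 \<longleftrightarrow> q = 0" for q :: quat
    by (simp add: norm_quat_def zero)
qed (auto simp: sgn_quat_def dist_quat_def uniformity_quat_def open_quat_def)

end

lemma bounded_linear_quat_to_R4: "bounded_linear quat_to_R4"
  by (rule bounded_linear_intro[where K = 1])
     (simp_all add: quat_to_R4_def plus_quat_def scaleR_quat_def norm_quat_def)

lemma bounded_linear_quat_of_R4: "bounded_linear (\<lambda>(x, y, z, w). Quat x y z w)"
  by (rule bounded_linear_intro[where K = 1])
     (auto simp: quat_to_R4_def plus_quat_def scaleR_quat_def norm_quat_def)

lemma continuous_on_quat_iff:
  "continuous_on S f \<longleftrightarrow>
     continuous_on S (\<lambda>t. qRe (f t)) \<and> continuous_on S (\<lambda>t. qIm1 (f t)) \<and>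
     continuous_on S (\<lambda>t. qIm2 (f t)) \<and> continuous_on S (\<lambda>t. qIm3 (f t))"
  (is "?L \<longleftrightarrow> ?R")
proof
  assume ?L
  then have *: "continuous_on S (\<lambda>t. quat_to_R4 (f t))"
    by (rule bounded_linear.continuous_on[OF bounded_linear_quat_to_R4])
  show ?R
    using continuous_on_fst[OF *] continuous_on_fst[OF continuous_on_snd[OF *]]
      continuous_on_fst[OF continuous_on_snd[OF continuous_on_snd[OF *]]]
      continuous_on_snd[OF continuous_on_snd[OF continuous_on_snd[OF *]]]
    by (simp add: quat_to_R4_def)
next
  assume ?R
  then have "continuous_on S (\<lambda>t. (qRe (f t), qIm1 (f t), qIm2 (f t), qIm3 (f t)))"
    by (intro continuous_on_Pair) auto
  from bounded_linear.continuous_on[OF bounded_linear_quat_of_R4 this] show ?L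
    by simp
qed

text \<open>\<open>qcomp q n\<close> is the coefficient $q_n$ in $q = q_0 + i q_1 + j q_2 + k q_3$; it is
  meaningful only for \<open>n \<in> {0,1,2,3}\<close>.\<close>

definition qcomp :: "quat \<Rightarrow> nat \<Rightarrow> real" where
  "qcomp q n = [qRe q, qIm1 q, qIm2 q, qIm3 q] ! n"

section \<open>Symbols of quaternions\<close>

definition symE :: "real^4^4" where
  "symE = mat 1"

definition symI :: "real^4^4" where
  "symI = vector [vector [ 0,  1,  0,  0],
                  vector [-1,  0,  0,  0],
                  vector [ 0,  0,  0,  1],
                  vector [ 0,  0, -1,  0]]"

definition symJ :: "real^4^4" where
  "symJ = vector [vector [ 0,  0,  1,  0],
                  vector [ 0,  0,  0, -1],
                  vector [-1,  0,  0,  0],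
                  vector [ 0,  1,  0,  0]]"

definition symK :: "real^4^4" where
  "symK = vector [vector [ 0,  0,  0, -1],
                  vector [ 0,  0, -1,  0],
                  vector [ 0,  1,  0,  0],
                  vector [ 1,  0,  0,  0]]"

definition symbol :: "quat \<Rightarrow> real^4^4" where
  "symbol m = qcomp m 0 *\<^sub>R symE + qcomp m 1 *\<^sub>R symI + qcomp m 2 *\<^sub>R symJ + qcomp m 3 *\<^sub>R symK"

lemma symbol_mult: "symbol (q * r) = symbol q ** symbol r"
  by (simp add: symbol_def qcomp_def symE_def symI_def symJ_def symK_def vec_eq_iff forall_4 sum_4
      matrix_matrix_mult_def mat_def vector_def times_quat_def algebra_simps)

section \<open>The linear system\<close>

text \<open>Functions on $[t_0,+\infty)$ are total functions on the reals of which only the values on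
  \<open>{t0..}\<close> matter; the derivative at \<open>t0\<close> is one-sided. For continuous \<open>a b c d\<close> the equations
  force the derivatives to be continuous, so continuous differentiability is no extra condition.\<close>

definition solves_system ::
  "real \<Rightarrow> (real \<Rightarrow> quat) \<Rightarrow> (real \<Rightarrow> quat) \<Rightarrow> (real \<Rightarrow> quat) \<Rightarrow> (real \<Rightarrow> quat) \<Rightarrow>
   (real \<Rightarrow> real^4) \<Rightarrow> (real \<Rightarrow> real^4) \<Rightarrow> bool" where
  "solves_system t0 a b c d \<phi> \<psi> \<longleftrightarrow>
     (\<forall>t\<ge>t0.
        (\<phi> has_vector_derivative (symbol (c t) *v \<phi> t + symbol (a t) *v \<psi> t)) (at t within {t0..}) \<and>
        (\<psi> has_vector_derivative (- (symbol (d t) *v \<phi> t) - symbol (b t) *v \<psi> t)) (at t within {t0..}))"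

definition completely_non_conjugate ::
  "real \<Rightarrow> (real \<Rightarrow> real^4) \<Rightarrow> (real \<Rightarrow> real^4) \<Rightarrow> bool" where
  "completely_non_conjugate t0 \<phi> \<psi> \<longleftrightarrow> (\<forall>t\<ge>t0. \<phi> t \<noteq> 0 \<and> \<psi> t \<noteq> 0)"

definition initial_matrix :: "(nat \<Rightarrow> real) \<Rightarrow> real^4^4" where
  "initial_matrix \<gamma> = \<gamma> 0 *\<^sub>R symE - \<gamma> 1 *\<^sub>R symI - \<gamma> 2 *\<^sub>R symJ - \<gamma> 3 *\<^sub>R symK"

section \<open>Discriminants and quintuples\<close>

text \<open>The arguments \<open>a b c d\<close> below are the values of the coefficients at one instant. In $p_{n,m}$
  the sign of $c_m$ is $+$ precisely for $n = 0$ and for $m = n$.\<close>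

definition pcoef :: "quat \<Rightarrow> quat \<Rightarrow> nat \<Rightarrow> nat \<Rightarrow> real" where
  "pcoef b c n m = (if n = 0 \<or> m = n then qcomp b m + qcomp c m else qcomp b m - qcomp c m)"

definition discr :: "quat \<Rightarrow> quat \<Rightarrow> quat \<Rightarrow> quat \<Rightarrow> nat \<Rightarrow> real" where
  "discr a b c d n =
     (if n = 0
      then (if qcomp a 0 \<noteq> 0 then (\<Sum>m=1..3. (pcoef b c 0 m)\<^sup>2) + 4 * qcomp a 0 * qcomp d 0
            else 4 * qcomp d 0)
      else (if qcomp a n \<noteq> 0 then (\<Sum>m=1..3. (pcoef b c n m)\<^sup>2) - 4 * qcomp a n * qcomp d n
            else - 4 * qcomp d n))"

type_synonym quintuple = "real \<times> real \<times> real \<times> real \<times> real"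

fun semi_definite_positive :: "real \<Rightarrow> quintuple \<Rightarrow> bool" where
  "semi_definite_positive \<epsilon> (p, q, r, s, l) \<longleftrightarrow>
     p > 0 \<and> l > 0 \<and>
     (Max {q, r, s} \<ge> sqrt (l + \<epsilon>) \<or>
      (0 \<le> Min {q, r, s} \<and> Min {q, r, s} \<le> Max {q, r, s} \<and> Max {q, r, s} \<le> sqrt (l + \<epsilon>) \<and>
       q\<^sup>2 + r\<^sup>2 + s\<^sup>2 \<ge> l + \<epsilon>))"

definition quintuple0 :: "quat \<Rightarrow> quat \<Rightarrow> quat \<Rightarrow> quat \<Rightarrow> quintuple" where
  "quintuple0 a b c d =
     (qcomp a 0, - qcomp b 1 - qcomp c 1, - qcomp b 2 - qcomp c 2, - qcomp b 3 - qcomp c 3,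
      discr a b c d 0)"

definition quintuple1 :: "quat \<Rightarrow> quat \<Rightarrow> quat \<Rightarrow> quat \<Rightarrow> quintuple" where
  "quintuple1 a b c d =
     (qcomp a 1, qcomp b 1 + qcomp c 1, - qcomp b 2 + qcomp c 2, qcomp b 3 - qcomp c 3,
      discr a b c d 1)"

definition quintuple2 :: "quat \<Rightarrow> quat \<Rightarrow> quat \<Rightarrow> quat \<Rightarrow> quintuple" where
  "quintuple2 a b c d =
     (qcomp a 2, qcomp b 1 - qcomp c 1, qcomp b 2 + qcomp c 2, - qcomp b 3 + qcomp c 3,
      discr a b c d 2)"

definition quintuple3 :: "quat \<Rightarrow> quat \<Rightarrow> quat \<Rightarrow> quat \<Rightarrow> quintuple" where
  "quintuple3 a b c d =
     (qcomp a 3, - qcomp b 1 + qcomp c 1, qcomp b 2 - qcomp c 2, qcomp b 3 + qcomp c 3,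
      discr a b c d 3)"

end

theory Submission
  imports Defs
begin

text \<open>
  Through the symbols, $\mathbb{R}^4$ is a one-dimensional left module over the quaternions, so
  \<open>\<phi>\<close> and \<open>\<psi>\<close> may be read as quaternions. Where \<open>\<phi> \<noteq> 0\<close> the quotient
  $y = \psi\varphi^{-1}$ solves the Riccati equation $y' + yay + by + yc + d = 0$, and the initial
  condition prescribes $y(t_0) = \gamma_0 - i\gamma_1 - j\gamma_2 - k\gamma_3$. The quotient may
  blow up, whereas $z = \psi\bar\varphi = |\varphi|^2 y$ is defined for all times. Its signed
  components $x_0 = z_0$ and $x_n = -z_n$ for $n = 1, 2, 3$ are the bilinear forms
  \<open>riccati_coord n \<phi> \<psi>\<close>. If one of them stays positive, then neither \<open>\<phi>\<close> nor \<open>\<psi>\<close> can vanish,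
  which is all there is to prove.

  Each of them satisfies $x_n' = (c_0 - b_0)\,x_n + F_n$ (lemma \<open>riccati_coord_has_derivative\<close>),
  where the forcing $F_n$ is $a_n|\psi|^2$ plus a multiple of $|\varphi|^2$ plus a linear
  combination of the other three $x_m$. Since $\sum_n x_n^2 = |\varphi|^2|\psi|^2$, the
  Cauchy--Schwarz inequality bounds the linear combination by the two squares, and the conditions
  $a_n \ge 0$ and $D_n \le 0$ make $F_n \ge 0$ whatever the signs of the $x_m$
  (lemma \<open>form_nonneg_if_discr_nonpos\<close>). Then $x_n$ times an integrating factor is nondecreasing,
  so $x_n$ stays positive if $\gamma_n > 0$; this settles the first part.

  For $D_n > 0$ a quintuple that is $\varepsilon$-semi definite positive still gives $F_n \ge 0$
  as long as all $x_m$ are nonnegative: a part of the linear combination with nonnegative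
  coefficients can be discarded, and the discriminant of what remains is negative (lemma
  \<open>forcing_nonneg_if_semi_definite_positive\<close>). Starting with all $x_n > 0$, a solution cannot
  reach the boundary of the positive cone for a first time, since each $x_n$, rescaled, has been
  nondecreasing up to that time (lemma \<open>positive_cone_invariant\<close>); this settles the second part.
\<close>

section \<open>Signed components of the quaternionic Riccati quotient\<close>

text \<open>The matrix is the symbol of $1, -i, -j, -k$ for $n = 0, 1, 2, 3$, so these are the
  coordinates of $\psi\bar\varphi$ in that basis. The signs are those of the initial condition.\<close>

definition riccati_coord :: "nat \<Rightarrow> real^4 \<Rightarrow> real^4 \<Rightarrow> real" where
  "riccati_coord n \<phi> \<psi> = \<psi> \<bullet> (initial_matrix (\<lambda>m. of_bool (m = n)) *v \<phi>)"

text \<open>Up to sign, the units $1, i, j, k$ multiply like the Klein four-group: the product of the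
  units with the numbers \<open>n\<close> and \<open>m\<close> is, up to sign, the unit with the number \<open>partner n m\<close>. The
  coefficient $p_{n,m}$ therefore couples $x_n$ to $x_{\mathrm{partner}\,n\,m}$; for distinct
  $n, m \ge 1$ the partner is the third imaginary unit, as $1 + 2 + 3 = 6$.\<close>

definition partner :: "nat \<Rightarrow> nat \<Rightarrow> nat" where
  "partner n m = (if n = 0 then m else if m = n then 0 else 6 - n - m)"

text \<open>The signs are those with which the $p_{n,m}$ enter the second to fourth entries of the
  quintuples: negative for the real component and for the cyclic pairs $(1,2), (2,3), (3,1)$.\<close>

definition lin_coef :: "quat \<Rightarrow> quat \<Rightarrow> nat \<Rightarrow> nat \<Rightarrow> real" where
  "lin_coef b c n m =
     (if n = 0 \<or> (n, m) \<in> {(1, 2), (2, 3), (3, 1)} then - pcoef b c n m else pcoef b c n m)"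

definition const_coef :: "quat \<Rightarrow> nat \<Rightarrow> real" where
  "const_coef d n = (if n = 0 then - qcomp d 0 else qcomp d n)"

definition forcing :: "quat \<Rightarrow> quat \<Rightarrow> quat \<Rightarrow> quat \<Rightarrow> nat \<Rightarrow> real^4 \<Rightarrow> real^4 \<Rightarrow> real" where
  "forcing a b c d n \<phi> \<psi> =
     qcomp a n * (\<psi> \<bullet> \<psi>) + const_coef d n * (\<phi> \<bullet> \<phi>)
     + (\<Sum>m=1..3. lin_coef b c n m * riccati_coord (partner n m) \<phi> \<psi>)"

lemma initial_matrix_mult_vec:
  "initial_matrix \<gamma> *v v = vector
     [\<gamma> 0 * v $ 1 - \<gamma> 1 * v $ 2 - \<gamma> 2 * v $ 3 + \<gamma> 3 * v $ 4,
      \<gamma> 0 * v $ 2 + \<gamma> 1 * v $ 1 + \<gamma> 2 * v $ 4 + \<gamma> 3 * v $ 3,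
      \<gamma> 0 * v $ 3 - \<gamma> 1 * v $ 4 + \<gamma> 2 * v $ 1 - \<gamma> 3 * v $ 2,
      \<gamma> 0 * v $ 4 + \<gamma> 1 * v $ 3 - \<gamma> 2 * v $ 2 - \<gamma> 3 * v $ 1]"
  by (simp add: initial_matrix_def symE_def symI_def symJ_def symK_def vec_eq_iff forall_4 sum_4
      matrix_vector_mult_def mat_def vector_def algebra_simps)

lemma symbol_eq_initial_matrix:
  "symbol q = initial_matrix (\<lambda>n. if n = 0 then qcomp q 0 else - qcomp q n)"
  by (simp add: symbol_def initial_matrix_def)

lemma inner_vec4: "(v :: real^4) \<bullet> w = v $ 1 * w $ 1 + v $ 2 * w $ 2 + v $ 3 * w $ 3 + v $ 4 * w $ 4"
  by (simp add: inner_vec_def sum_4)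

lemma vector_4_nth:
  "(vector [x, y, z, w] :: real^4) $ 1 = x" "(vector [x, y, z, w] :: real^4) $ 2 = y"
  "(vector [x, y, z, w] :: real^4) $ 3 = z" "(vector [x, y, z, w] :: real^4) $ 4 = w"
  by (simp_all add: vector_def)

text \<open>The range is written with \<open>Suc 0\<close> because the simplifier rewrites its lower bound to that.\<close>

lemma sum_1_to_3: "(\<Sum>m=Suc 0..3. f m) = f 1 + f 2 + (f 3 :: real)"
  by (simp add: eval_nat_numeral)

lemmas coord_simps = riccati_coord_def symbol_eq_initial_matrix initial_matrix_mult_vec
  inner_vec4 vector_4_nth

text \<open>This is the multiplicativity $|\psi\bar\varphi|^2 = |\psi|^2|\varphi|^2$ of the quaternion
  norm, that is, Euler's four-square identity.\<close>

lemma riccati_coord_square_sum: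
  "(\<Sum>n\<in>{0, 1, 2, 3}. (riccati_coord n \<phi> \<psi>)\<^sup>2) = (\<phi> \<bullet> \<phi>) * (\<psi> \<bullet> \<psi>)"
  by (simp add: coord_simps power2_eq_square algebra_simps)

text \<open>For an initial value $\psi = \hat y\varphi$ one has $\psi\bar\varphi = y|\varphi|^2$.\<close>

lemma riccati_coord_initial:
  assumes "n \<in> {0, 1, 2, 3}"
  shows "riccati_coord n \<phi> (initial_matrix \<gamma> *v \<phi>) = \<gamma> n * (\<phi> \<bullet> \<phi>)"
  using assms by (auto simp: coord_simps algebra_simps)

text \<open>From $z' = \psi'\bar\varphi + \psi\bar\varphi'$ and the system,
  $z' = -d|\varphi|^2 - bz + z\bar c + |\psi|^2\bar a$. The real parts of \<open>b\<close> and \<open>c\<close> act on each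
  component by the same factor; the imaginary parts only mix different components, so that
  everything else can be collected in the forcing.\<close>

lemma riccati_coord_rate:
  assumes "n \<in> {0, 1, 2, 3}"
  shows "riccati_coord n \<phi> (- (symbol d *v \<phi>) - symbol b *v \<psi>)
       + riccati_coord n (symbol c *v \<phi> + symbol a *v \<psi>) \<psi>
       = (qcomp c 0 - qcomp b 0) * riccati_coord n \<phi> \<psi> + forcing a b c d n \<phi> \<psi>"
  using assms
  by (auto simp only: insert_iff empty_iff)
     (simp_all add: coord_simps forcing_def const_coef_def lin_coef_def pcoef_def partner_def
      sum_1_to_3 algebra_simps)

lemma riccati_coord_has_derivative:
  assumes sol: "solves_system t0 a b c d \<phi> \<psi>" and t: "t \<ge> t0" and n: "n \<in> {0, 1, 2, 3}"
  shows "((\<lambda>t. riccati_coord n (\<phi> t) (\<psi> t)) has_real_derivative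
      (qcomp (c t) 0 - qcomp (b t) 0) * riccati_coord n (\<phi> t) (\<psi> t)
      + forcing (a t) (b t) (c t) (d t) n (\<phi> t) (\<psi> t)) (at t within {t0..})"
proof -
  let ?Q = "initial_matrix (\<lambda>m. of_bool (m = n))"
  have d\<phi>: "(\<phi> has_vector_derivative (symbol (c t) *v \<phi> t + symbol (a t) *v \<psi> t)) (at t within {t0..})"
    and d\<psi>: "(\<psi> has_vector_derivative (- (symbol (d t) *v \<phi> t) - symbol (b t) *v \<psi> t)) (at t within {t0..})"
    using sol t by (auto simp: solves_system_def)
  have "((\<lambda>t. ?Q *v \<phi> t) has_vector_derivative
      (?Q *v (symbol (c t) *v \<phi> t + symbol (a t) *v \<psi> t))) (at t within {t0..})"
    by (rule bounded_linear.has_vector_derivative[OF matrix_vector_mul_bounded_linear d\<phi>])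
  from bounded_bilinear.has_vector_derivative[OF bounded_bilinear_inner d\<psi> this]
  show ?thesis
    unfolding has_real_derivative_iff_has_vector_derivative riccati_coord_rate[OF n, symmetric]
      by (simp add: riccati_coord_def add.commute)
qed

lemma continuous_on_rate:
  assumes "continuous_on {t0..} b" "continuous_on {t0..} c"
  shows "continuous_on {t0..} (\<lambda>t. qcomp (c t) 0 - qcomp (b t) 0)"
  using assms by (auto simp: continuous_on_quat_iff qcomp_def intro!: continuous_intros)

section \<open>Sign of the forcing\<close>

text \<open>If \<open>N > 0\<close> and $NM = |x|^2$, the expression is \<open>N\<close> times the polynomial
  $a|u|^2 + q \cdot u + \delta$ at $u = x/N$, whose discriminant $|q|^2 - 4a\delta$ is nonpositive.
  The homogeneous form covers the times with \<open>N = 0\<close>, where $u$ is undefined.\<close>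

lemma form_nonneg_if_discr_nonpos:
  fixes a \<delta> M N :: real and q x :: "nat \<Rightarrow> real"
  assumes "a \<ge> 0" "\<delta> \<ge> 0" "M \<ge> 0" "N \<ge> 0"
    and discr: "(\<Sum>m\<in>I. (q m)\<^sup>2) \<le> 4 * a * \<delta>" and x: "(\<Sum>m\<in>I. (x m)\<^sup>2) \<le> N * M"
  shows "a * M + \<delta> * N + (\<Sum>m\<in>I. q m * x m) \<ge> 0"
proof -
  have "(\<Sum>m\<in>I. q m * x m)\<^sup>2 \<le> (\<Sum>m\<in>I. (q m)\<^sup>2) * (\<Sum>m\<in>I. (x m)\<^sup>2)"
    by (rule Cauchy_Schwarz_ineq_sum)
  also have "\<dots> \<le> (4 * a * \<delta>) * (N * M)"
    using assms by (intro mult_mono) (auto intro: sum_nonneg)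
  \<comment> \<open>The arithmetic-geometric mean inequality for \<open>a * M\<close> and \<open>\<delta> * N\<close>.\<close>
  also have "\<dots> \<le> (a * M + \<delta> * N)\<^sup>2"
    using sum_squares_bound[of "a * M" "\<delta> * N"] by (simp add: power2_sum algebra_simps)
  finally have "\<bar>\<Sum>m\<in>I. q m * x m\<bar> \<le> a * M + \<delta> * N"
    using assms by (simp add: abs_le_square_iff[symmetric])
  then show ?thesis by linarith
qed

text \<open>The partners of \<open>n\<close> are the three indices other than \<open>n\<close>, so only $x_n^2$ is lost.\<close>

lemma partner_coords_square_le:
  assumes "n \<in> {0, 1, 2, 3}"
  shows "(\<Sum>m=1..3. (riccati_coord (partner n m) \<phi> \<psi>)\<^sup>2) \<le> (\<phi> \<bullet> \<phi>) * (\<psi> \<bullet> \<psi>)"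
  unfolding riccati_coord_square_sum[symmetric] using assms
  by (auto simp: sum_1_to_3 partner_def)

lemma lin_coef_square: "(lin_coef b c n m)\<^sup>2 = (pcoef b c n m)\<^sup>2"
  by (simp add: lin_coef_def)

lemma discr_eq:
  "discr a b c d n =
     (if qcomp a n = 0 then - 4 * const_coef d n
      else (\<Sum>m=1..3. (lin_coef b c n m)\<^sup>2) - 4 * qcomp a n * const_coef d n)"
  by (auto simp: discr_def const_coef_def lin_coef_square)

text \<open>Where $a_n = 0$ the vanishing of the $p_{n,m}$ removes the linear terms, and $D_n$ degenerates
  to a multiple of the coefficient of $|\varphi|^2$.\<close>

lemma forcing_nonneg_if_discr_nonpos:
  assumes n: "n \<in> {0, 1, 2, 3}" and a: "qcomp a n \<ge> 0"
    and degenerate: "qcomp a n = 0 \<Longrightarrow> \<forall>m\<in>{1, 2, 3}. pcoef b c n m = 0"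
    and D: "discr a b c d n \<le> 0"
  shows "forcing a b c d n \<phi> \<psi> \<ge> 0"
  unfolding forcing_def
proof (rule form_nonneg_if_discr_nonpos)
  show discr: "(\<Sum>m=1..3. (lin_coef b c n m)\<^sup>2) \<le> 4 * qcomp a n * const_coef d n"
  proof (cases "qcomp a n = 0")
    case True
    with degenerate show ?thesis
      unfolding lin_coef_square by (simp add: sum_1_to_3)
  next
    case False
    with D show ?thesis by (simp add: discr_eq)
  qed
  show "const_coef d n \<ge> 0"
  proof (cases "qcomp a n = 0")
    case True
    with D show ?thesis by (simp add: discr_eq)
  next
    case False
    have "0 \<le> 4 * qcomp a n * const_coef d n"
      using discr by (rule order_trans[rotated]) (auto intro: sum_nonneg)
    then show ?thesis
      using a False by (simp add: zero_le_mult_iff)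
  qed
qed (use a partner_coords_square_le[OF n] in auto)

text \<open>One formula in \<open>n\<close> for the four quintuples, so that they can be treated alike.\<close>

definition quintuple :: "quat \<Rightarrow> quat \<Rightarrow> quat \<Rightarrow> quat \<Rightarrow> nat \<Rightarrow> quintuple" where
  "quintuple a b c d n =
     (qcomp a n, lin_coef b c n 1, lin_coef b c n 2, lin_coef b c n 3, discr a b c d n)"

lemma quintuple_simps:
  "quintuple a b c d 0 = quintuple0 a b c d"
  "quintuple a b c d 1 = quintuple1 a b c d"
  "quintuple a b c d 2 = quintuple2 a b c d"
  "quintuple a b c d 3 = quintuple3 a b c d"
  by (simp_all add: quintuple_def quintuple0_def quintuple1_def quintuple2_def quintuple3_def
      lin_coef_def pcoef_def)

text \<open>Write $\delta_n$ for the coefficient of $|\varphi|^2$, so that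
  $q^2 + r^2 + s^2 = l + 4a_n\delta_n$. Both alternatives of the definition provide a set \<open>J\<close> of
  nonnegative entries among $q, r, s$ whose squares add up to at least $l + \varepsilon$: a single
  large entry, or all three. The terms in \<open>J\<close> are nonnegative on the positive cone, and the squares
  of the other entries add up to at most $4a_n\delta_n - \varepsilon$, so that the homogeneous form
  without the terms in \<open>J\<close> is nonnegative by its discriminant.\<close>

lemma forcing_nonneg_if_semi_definite_positive:
  assumes n: "n \<in> {0, 1, 2, 3}" and \<epsilon>: "\<epsilon> > 0"
    and Q: "semi_definite_positive \<epsilon> (quintuple a b c d n)"
    and x: "\<And>m. m \<in> {0, 1, 2, 3} \<Longrightarrow> riccati_coord m \<phi> \<psi> \<ge> 0"
  shows "forcing a b c d n \<phi> \<psi> \<ge> 0"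
proof -
  define q where "q = lin_coef b c n"
  define y where "y m = riccati_coord (partner n m) \<phi> \<psi>" for m
  define l where "l = discr a b c d n"
  have a: "qcomp a n > 0" and l0: "l > 0"
    and alt: "Max {q 1, q 2, q 3} \<ge> sqrt (l + \<epsilon>) \<or>
      0 \<le> Min {q 1, q 2, q 3} \<and> (q 1)\<^sup>2 + (q 2)\<^sup>2 + (q 3)\<^sup>2 \<ge> l + \<epsilon>"
    using Q by (auto simp: quintuple_def q_def l_def)
  have l: "l = (\<Sum>m=1..3. (q m)\<^sup>2) - 4 * qcomp a n * const_coef d n"
    using a by (simp add: q_def l_def discr_eq)
  have indices: "{1..3} = {1, 2, 3::nat}" by auto
  have "\<exists>J \<subseteq> {1..3}. (\<forall>m\<in>J. q m \<ge> 0) \<and> (\<Sum>m\<in>J. (q m)\<^sup>2) \<ge> l + \<epsilon>"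
  proof (cases "Max {q 1, q 2, q 3} \<ge> sqrt (l + \<epsilon>)")
    case True
    then obtain m where m: "m \<in> {1..3}" "q m \<ge> sqrt (l + \<epsilon>)"
      unfolding indices by (auto simp: le_max_iff_disj)
    have "sqrt (l + \<epsilon>) \<ge> 0"
      using l0 \<epsilon> by simp
    with m(2) have "q m \<ge> 0" by linarith
    moreover have "(q m)\<^sup>2 \<ge> l + \<epsilon>"
      using m(2) by (rule sqrt_le_D)
    ultimately show ?thesis
      using m(1) by (intro exI[of _ "{m}"]) auto
  next
    case False
    then show ?thesis
      using alt unfolding indices by (intro exI[of _ "{1, 2, 3}"]) auto
  qed
  then obtain J where J: "J \<subseteq> {1..3}" "\<And>m. m \<in> J \<Longrightarrow> q m \<ge> 0" "(\<Sum>m\<in>J. (q m)\<^sup>2) \<ge> l + \<epsilon>"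
    by blast
  have y: "y m \<ge> 0" if "m \<in> {1..3}" for m
    unfolding y_def using n that by (intro x) (auto simp: partner_def)
  have split: "(\<Sum>m=1..3. f m) = (\<Sum>m\<in>{1..3} - J. f m) + (\<Sum>m\<in>J. f m)" for f :: "nat \<Rightarrow> real"
    using J(1) by (intro sum.subset_diff) auto
  have rest: "(\<Sum>m\<in>{1..3} - J. (q m)\<^sup>2) \<le> 4 * qcomp a n * const_coef d n"
    using J(3) l \<epsilon> split[of "\<lambda>m. (q m)\<^sup>2"] by simp
  have "qcomp a n * (\<psi> \<bullet> \<psi>) + const_coef d n * (\<phi> \<bullet> \<phi>) + (\<Sum>m\<in>{1..3} - J. q m * y m) \<ge> 0"
  proof (rule form_nonneg_if_discr_nonpos)
    have "0 \<le> 4 * qcomp a n * const_coef d n"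
      using rest by (rule order_trans[rotated]) (auto intro: sum_nonneg)
    then show "const_coef d n \<ge> 0"
      using a by (simp add: zero_le_mult_iff)
    have "(\<Sum>m\<in>{1..3} - J. (y m)\<^sup>2) \<le> (\<Sum>m=1..3. (y m)\<^sup>2)"
      by (intro sum_mono2) auto
    then show "(\<Sum>m\<in>{1..3} - J. (y m)\<^sup>2) \<le> (\<phi> \<bullet> \<phi>) * (\<psi> \<bullet> \<psi>)"
      using partner_coords_square_le[OF n, of \<phi> \<psi>] by (simp add: y_def)
  qed (use a rest in auto)
  moreover have "(\<Sum>m\<in>J. q m * y m) \<ge> 0"
    using J y by (intro sum_nonneg mult_nonneg_nonneg) auto
  ultimately show ?thesis
    using split[of "\<lambda>m. q m * y m"] by (simp add: forcing_def q_def y_def)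
qed

section \<open>Invariance of the positive cone\<close>

text \<open>The integrating factor $\exp(-\int_{t_0}^t k)$ turns $f' \ge kf$ into monotonicity.\<close>

lemma pos_if_linear_differential_inequality:
  fixes f k :: "real \<Rightarrow> real"
  assumes T: "t0 \<le> T" and k: "continuous_on {t0..T} k"
    and f: "\<And>t. t \<in> {t0..T} \<Longrightarrow> (f has_real_derivative k t * f t + g t) (at t within {t0..T})"
    and g: "\<And>t. t \<in> {t0..T} \<Longrightarrow> g t \<ge> 0"
    and init: "f t0 > 0"
  shows "f T > 0"
proof -
  define F where "F t = integral {t0..t} k" for t
  have F: "(F has_real_derivative k t) (at t within {t0..T})" if "t \<in> {t0..T}" for t
    unfolding F_def by (rule integral_has_real_derivative[OF k that])
  show ?thesis
  proof (cases "t0 = T")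
    case True
    with init show ?thesis by simp
  next
    case False
    have der: "((\<lambda>t. f t * exp (- F t)) has_derivative (\<lambda>h. (g t * exp (- F t)) * h)) (at t within {t0..T})"
      if "t \<in> {t0..T}" for t
      using that unfolding has_field_derivative_def[symmetric]
      by (auto intro!: derivative_eq_intros f F simp: algebra_simps)
    obtain s where s: "s \<in> {t0<..<T}"
      "f T * exp (- F T) - f t0 * exp (- F t0) = (g s * exp (- F s)) * (T - t0)"
      using mvt_simple[of t0 T "\<lambda>t. f t * exp (- F t)", OF _ der] T False by auto
    have "(g s * exp (- F s)) * (T - t0) \<ge> 0"
      using s(1) T g by (intro mult_nonneg_nonneg) auto
    moreover have "f t0 * exp (- F t0) > 0"
      using init by simp
    ultimately have "f T * exp (- F T) > 0"
      using s(2) by linarith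
    then show ?thesis
      by (simp add: zero_less_mult_iff)
  qed
qed

text \<open>The inequality $f_i' \ge k f_i$ is available only while all functions are nonnegative. Up to
  the first time \<open>T\<close> at which one of them is not positive this is so, and then the previous lemma
  keeps all of them positive at \<open>T\<close> itself.\<close>

lemma positive_cone_invariant:
  fixes f g :: "'i \<Rightarrow> real \<Rightarrow> real"
  assumes I: "finite I" and k: "continuous_on {t0..} k"
    and f: "\<And>i t. i \<in> I \<Longrightarrow> t \<ge> t0 \<Longrightarrow>
      (f i has_real_derivative k t * f i t + g i t) (at t within {t0..})"
    and g: "\<And>i t. i \<in> I \<Longrightarrow> t \<ge> t0 \<Longrightarrow> (\<And>j. j \<in> I \<Longrightarrow> f j t \<ge> 0) \<Longrightarrow> g i t \<ge> 0"
    and init: "\<And>i. i \<in> I \<Longrightarrow> f i t0 > 0"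
    and "i \<in> I" "t \<ge> t0"
  shows "f i t > 0"
proof (rule ccontr)
  assume neg: "\<not> f i t > 0"
  have cont: "continuous_on {t0..} (f j)" if "j \<in> I" for j
    using f[OF that] by (auto intro!: DERIV_continuous_on)
  \<comment> \<open>The set of bad times is closed, so its infimum \<open>T\<close> is itself bad.\<close>
  define B where "B = (\<Union>j\<in>I. {s \<in> {t0..}. f j s \<le> 0})"
  have "closed B"
    unfolding B_def using I cont
    by (intro closed_UN ballI continuous_on_closed_Collect_le continuous_on_const closed_atLeast) auto
  moreover have B: "B \<noteq> {}" "bdd_below B"
    using neg \<open>i \<in> I\<close> \<open>t \<ge> t0\<close> by (force simp: B_def, auto simp: B_def intro!: bdd_belowI[of _ t0])
  ultimately have "Inf B \<in> B"
    by (intro closed_contains_Inf)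
  then obtain j where j: "j \<in> I" "f j (Inf B) \<le> 0" and T: "t0 \<le> Inf B"
    by (auto simp: B_def)
  define T where "T = Inf B"
  have before: "f m s > 0" if "m \<in> I" "s \<in> {t0..<T}" for m s
    using cInf_lower[of s B] B that by (force simp: B_def T_def)
  have "T \<noteq> t0"
    using init j by (force simp: T_def)
  then have "t0 < T" using T by (simp add: T_def)
  have upto: "f m s \<ge> 0" if "m \<in> I" "s \<in> {t0..T}" for m s
  proof -
    have "closure {t0..<T} = {t0..T}"
      using \<open>t0 < T\<close> by simp
    moreover have "continuous_on {t0..T} (f m)"
      using cont[OF that(1)] by (rule continuous_on_subset) auto
    ultimately show ?thesis
      using continuous_ge_on_closure[of "{t0..<T}" "f m" s 0] before[OF that(1)] that(2)
      by (simp add: less_imp_le)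
  qed
  have "f j T > 0"
  proof (rule pos_if_linear_differential_inequality[of t0 T k "f j" "g j"])
    show "t0 \<le> T" using \<open>t0 < T\<close> by simp
    show "continuous_on {t0..T} k"
      using k by (rule continuous_on_subset) auto
    show "(f j has_real_derivative k s * f j s + g j s) (at s within {t0..T})" if "s \<in> {t0..T}" for s
      using f[OF j(1), of s] that by (auto intro: DERIV_subset)
    show "g j s \<ge> 0" if "s \<in> {t0..T}" for s
      using that upto j by (intro g) auto
    show "f j t0 > 0"
      by (rule init[OF j(1)])
  qed
  with j(2) show False by (simp add: T_def)
qed

section \<open>Non-conjugation\<close>

text \<open>The coordinates are bilinear, so they vanish as soon as \<open>\<phi>\<close> or \<open>\<psi>\<close> does.\<close>

lemma completely_non_conjugate_if_coord_pos:
  assumes "\<And>t. t \<ge> t0 \<Longrightarrow> riccati_coord n (\<phi> t) (\<psi> t) > 0"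
  shows "completely_non_conjugate t0 \<phi> \<psi>"
  unfolding completely_non_conjugate_def
proof (intro allI impI)
  fix t assume "t \<ge> t0"
  from assms[OF this] show "\<phi> t \<noteq> 0 \<and> \<psi> t \<noteq> 0"
    by (auto simp: riccati_coord_def)
qed

lemma riccati_coord_initial_pos:
  assumes "n \<in> {0, 1, 2, 3}" "\<gamma> n > 0" "initial_matrix \<gamma> *v \<phi> \<noteq> 0"
  shows "riccati_coord n \<phi> (initial_matrix \<gamma> *v \<phi>) > 0"
proof -
  have "\<phi> \<noteq> 0" using assms(3) by auto
  then show ?thesis
    using assms by (simp add: riccati_coord_initial[OF assms(1)])
qed

text \<open>A single index \<open>n\<close> suffices: the forcing is nonnegative whatever the signs of the other
  coordinates, so the half-space $x_n > 0$ is invariant by itself.\<close>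

lemma completely_non_conjugate_if_discr_nonpos:
  assumes b: "continuous_on {t0..} b" and c: "continuous_on {t0..} c"
    and sol: "solves_system t0 a b c d \<phi> \<psi>"
    and init: "\<psi> t0 = initial_matrix \<gamma> *v \<phi> t0" "initial_matrix \<gamma> *v \<phi> t0 \<noteq> 0"
    and n: "n \<in> {0, 1, 2, 3}" "\<gamma> n > 0"
    and a: "\<And>t. t \<ge> t0 \<Longrightarrow> qcomp (a t) n \<ge> 0"
    and degenerate: "\<And>t. t \<ge> t0 \<Longrightarrow> qcomp (a t) n = 0 \<Longrightarrow> \<forall>m\<in>{1, 2, 3}. pcoef (b t) (c t) n m = 0"
    and D: "\<And>t. t \<ge> t0 \<Longrightarrow> discr (a t) (b t) (c t) (d t) n \<le> 0"
  shows "completely_non_conjugate t0 \<phi> \<psi>"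
proof (rule completely_non_conjugate_if_coord_pos)
  fix t assume t: "t \<ge> t0"
  show "riccati_coord n (\<phi> t) (\<psi> t) > 0"
  proof (rule positive_cone_invariant[of "{n}" t0 _ "\<lambda>n t. riccati_coord n (\<phi> t) (\<psi> t)"])
    show "continuous_on {t0..} (\<lambda>t. qcomp (c t) 0 - qcomp (b t) 0)"
      by (rule continuous_on_rate[OF b c])
    show "((\<lambda>t. riccati_coord i (\<phi> t) (\<psi> t)) has_real_derivative
        (qcomp (c s) 0 - qcomp (b s) 0) * riccati_coord i (\<phi> s) (\<psi> s)
        + forcing (a s) (b s) (c s) (d s) i (\<phi> s) (\<psi> s)) (at s within {t0..})"
      if "i \<in> {n}" "s \<ge> t0" for i s
      using that n(1) by (intro riccati_coord_has_derivative[OF sol]) simp_all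
    show "forcing (a s) (b s) (c s) (d s) i (\<phi> s) (\<psi> s) \<ge> 0" if "i \<in> {n}" "s \<ge> t0" for i s
      using that forcing_nonneg_if_discr_nonpos[OF n(1) a degenerate D] by simp
    show "riccati_coord i (\<phi> t0) (\<psi> t0) > 0" if "i \<in> {n}" for i
      using that riccati_coord_initial_pos[OF n init(2)] by (simp add: init(1))
  qed (use t in simp_all)
qed

text \<open>Here each forcing is controlled only where all four coordinates are nonnegative, so that they
  have to be kept positive simultaneously.\<close>

lemma completely_non_conjugate_if_semi_definite_positive:
  assumes b: "continuous_on {t0..} b" and c: "continuous_on {t0..} c"
    and sol: "solves_system t0 a b c d \<phi> \<psi>"
    and init: "\<psi> t0 = initial_matrix \<gamma> *v \<phi> t0" "initial_matrix \<gamma> *v \<phi> t0 \<noteq> 0"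
    and \<gamma>: "\<And>n. n \<in> {0, 1, 2, 3} \<Longrightarrow> \<gamma> n > 0" and \<epsilon>: "\<epsilon> > 0"
    and Q: "\<And>n t. n \<in> {0, 1, 2, 3} \<Longrightarrow> t \<ge> t0 \<Longrightarrow>
      semi_definite_positive \<epsilon> (quintuple (a t) (b t) (c t) (d t) n)"
  shows "completely_non_conjugate t0 \<phi> \<psi>"
proof (rule completely_non_conjugate_if_coord_pos)
  fix t assume t: "t \<ge> t0"
  show "riccati_coord 0 (\<phi> t) (\<psi> t) > 0"
  proof (rule positive_cone_invariant[of "{0, 1, 2, 3}" t0 _ "\<lambda>n t. riccati_coord n (\<phi> t) (\<psi> t)"])
    show "continuous_on {t0..} (\<lambda>t. qcomp (c t) 0 - qcomp (b t) 0)"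
      by (rule continuous_on_rate[OF b c])
    show "((\<lambda>t. riccati_coord n (\<phi> t) (\<psi> t)) has_real_derivative
        (qcomp (c s) 0 - qcomp (b s) 0) * riccati_coord n (\<phi> s) (\<psi> s)
        + forcing (a s) (b s) (c s) (d s) n (\<phi> s) (\<psi> s)) (at s within {t0..})"
      if "n \<in> {0, 1, 2, 3}" "s \<ge> t0" for n s
      by (rule riccati_coord_has_derivative[OF sol that(2,1)])
    show "forcing (a s) (b s) (c s) (d s) n (\<phi> s) (\<psi> s) \<ge> 0"
      if "n \<in> {0, 1, 2, 3}" "s \<ge> t0"
        "\<And>m. m \<in> {0, 1, 2, 3} \<Longrightarrow> riccati_coord m (\<phi> s) (\<psi> s) \<ge> 0" for n s
      by (rule forcing_nonneg_if_semi_definite_positive[OF that(1) \<epsilon> Q[OF that(1,2)] that(3)])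
    show "riccati_coord n (\<phi> t0) (\<psi> t0) > 0" if "n \<in> {0, 1, 2, 3}" for n
      unfolding init(1) by (rule riccati_coord_initial_pos[OF that \<gamma>[OF that] init(2)])
  qed (use t in simp_all)
qed

theorem theorem5p1:
  fixes t0 :: real and a b c d :: "real \<Rightarrow> quat"
  assumes "continuous_on {t0..} a" and "continuous_on {t0..} b"
    and "continuous_on {t0..} c" and "continuous_on {t0..} d"
  shows
    "(\<forall>S \<gamma>.
        S \<subseteq> {0, 1, 2, 3} \<and> S \<noteq> {} \<and>
        (\<forall>t\<ge>t0. (\<forall>n\<in>S. qcomp (a t) n \<ge> 0) \<and>
                 (\<forall>n\<in>S. qcomp (a t) n = 0 \<longrightarrow> (\<forall>m\<in>{1, 2, 3}. pcoef (b t) (c t) n m = 0)) \<and>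
                 (\<forall>n\<in>{0, 1, 2, 3} - S. qcomp (a t) n = 0) \<and>
                 (\<forall>n\<in>S. discr (a t) (b t) (c t) (d t) n \<le> 0)) \<and>
        (\<forall>n\<in>S. \<gamma> n \<ge> 0) \<and> (\<Sum>n\<in>S. \<gamma> n) \<noteq> 0 \<longrightarrow>
        (\<forall>\<phi> \<psi>. solves_system t0 a b c d \<phi> \<psi> \<and>
                 \<psi> t0 = initial_matrix \<gamma> *v \<phi> t0 \<and> initial_matrix \<gamma> *v \<phi> t0 \<noteq> 0 \<longrightarrow>
                 completely_non_conjugate t0 \<phi> \<psi>)) \<and>
     (\<forall>\<epsilon> \<gamma>.
        \<epsilon> > 0 \<and>
        (\<forall>t\<ge>t0. semi_definite_positive \<epsilon> (quintuple0 (a t) (b t) (c t) (d t)) \<and>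
                 semi_definite_positive \<epsilon> (quintuple1 (a t) (b t) (c t) (d t)) \<and>
                 semi_definite_positive \<epsilon> (quintuple2 (a t) (b t) (c t) (d t)) \<and>
                 semi_definite_positive \<epsilon> (quintuple3 (a t) (b t) (c t) (d t))) \<and>
        (\<forall>n\<in>{0, 1, 2, 3}. \<gamma> n > 0) \<longrightarrow>
        (\<forall>\<phi> \<psi>. solves_system t0 a b c d \<phi> \<psi> \<and>
                 \<psi> t0 = initial_matrix \<gamma> *v \<phi> t0 \<and> initial_matrix \<gamma> *v \<phi> t0 \<noteq> 0 \<longrightarrow>
                 completely_non_conjugate t0 \<phi> \<psi>))"
proof (intro conjI allI impI; elim conjE)
  fix S :: "nat set" and \<gamma> :: "nat \<Rightarrow> real" and \<phi> \<psi>
  assume S: "S \<subseteq> {0, 1, 2, 3}"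
    and \<gamma>: "\<forall>n\<in>S. \<gamma> n \<ge> 0" "(\<Sum>n\<in>S. \<gamma> n) \<noteq> 0"
    and coef: "\<forall>t\<ge>t0. (\<forall>n\<in>S. qcomp (a t) n \<ge> 0) \<and>
      (\<forall>n\<in>S. qcomp (a t) n = 0 \<longrightarrow> (\<forall>m\<in>{1, 2, 3}. pcoef (b t) (c t) n m = 0)) \<and>
      (\<forall>n\<in>{0, 1, 2, 3} - S. qcomp (a t) n = 0) \<and>
      (\<forall>n\<in>S. discr (a t) (b t) (c t) (d t) n \<le> 0)"
    and sol: "solves_system t0 a b c d \<phi> \<psi>"
    and init: "\<psi> t0 = initial_matrix \<gamma> *v \<phi> t0" "initial_matrix \<gamma> *v \<phi> t0 \<noteq> 0"
  obtain n where n: "n \<in> S" "\<gamma> n > 0"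
    using \<gamma> by (metis less_eq_real_def sum.neutral)
  with S have "n \<in> {0, 1, 2, 3}" by blast
  then show "completely_non_conjugate t0 \<phi> \<psi>"
    using completely_non_conjugate_if_discr_nonpos[OF assms(2,3) sol init _ n(2)] coef n(1) by blast
next
  fix \<epsilon> :: real and \<gamma> :: "nat \<Rightarrow> real" and \<phi> \<psi>
  assume \<epsilon>: "\<epsilon> > 0" and \<gamma>: "\<forall>n\<in>{0, 1, 2, 3}. \<gamma> n > 0"
    and coef: "\<forall>t\<ge>t0. semi_definite_positive \<epsilon> (quintuple0 (a t) (b t) (c t) (d t)) \<and>
      semi_definite_positive \<epsilon> (quintuple1 (a t) (b t) (c t) (d t)) \<and>
      semi_definite_positive \<epsilon> (quintuple2 (a t) (b t) (c t) (d t)) \<and>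
      semi_definite_positive \<epsilon> (quintuple3 (a t) (b t) (c t) (d t))"
    and sol: "solves_system t0 a b c d \<phi> \<psi>"
    and init: "\<psi> t0 = initial_matrix \<gamma> *v \<phi> t0" "initial_matrix \<gamma> *v \<phi> t0 \<noteq> 0"
  have Q: "semi_definite_positive \<epsilon> (quintuple (a t) (b t) (c t) (d t) n)"
    if "n \<in> {0, 1, 2, 3}" "t \<ge> t0" for n t
    using coef that by (elim insertE) (simp_all only: quintuple_simps empty_iff)
  show "completely_non_conjugate t0 \<phi> \<psi>"
    by (rule completely_non_conjugate_if_semi_definite_positive[OF assms(2,3) sol init])
       (use \<gamma> \<epsilon> Q in blast)+
qed

end
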